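(* In the semi-synchronous No Simultaneity (NS) model, exploring a 1-interval connected ring is impossible with any number of agents (i.e. no algorithm guarantees that every node is eventually visited in every execution), even if the ring and the agents are not anonymous (nodes and agents have distinct identifiers) and there is chirality.
   Context: Ring: the nodes $v_0,\dots,v_{n-1}$ (indices modulo $n$) form a cycle; $v_i$ is linked to $v_{i-1}$ and $v_{i+1}$ via distinctly labelled ports $q_{i-}$ and $q_{i+}$ (labels need not be globally consistent). Time proceeds in rounds; in each round at most one edge, chosen by an adversary, is missing (1-interval connected ring). Agents: each has memory and computational power; all execute the same deterministic protocol (with identifiers, behaviour may depend on the identifier). They start at arbitrary, not necessarily distinct, nodes, cannot communicate explicitly and cannot mark nodes. Each agent $a_j$ has a consistent private orientation, i.e. a function $\lambda_j$ designating each port left or right with $\lambda_j(q_{i-})=\lambda_j(q_{k-})$ for all $i,k$. Chirality: all agents have the same orientation and are aware of it. Round: each active agent performs Look (it sees its own position within its node, i.e. whether it is on a port and which one, and the positions of the other agents at that node), Compute (from this snapshot and its memory it determines a direction in $\{left,right,nil\}$; if $nil$ it becomes inactive; otherwise it tries to access the corresponding port if not already there), and Move. Ports are accessed in mutual exclusion: an occupied port cannot be gained, and if several agents try the same port exactly one succeeds; an agent that fails sets $moved=false$ and becomes inactive. An agent on a port after computing moves to the other endpoint if the edge is present in this round (setting $moved=true$), and otherwise stays on the port (setting $moved=false$); in either case the port is denied to other agents in that round. Two agents crossing the same edge in opposite directions in the same round might not detect each other. Semi-synchronous ($\mathcal{SSYNC}$): in each round an adversary activates a non-empty subset of the agents,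 the others being asleep (passive); every agent is activated infinitely often; an activated agent does not know whether it was active in the previous round. An agent may be asleep on a port. NS model: a sleeping agent cannot move, and there is no further guarantee for an agent sleeping on a port. Exploration is solved if within finite time every node is visited by at least one agent, in every execution (all initial positions and all adversary choices of activations and missing edges). *)

theory Defs
  imports Main
begin

section \<open>Dynamic ring, agents and protocols\<close>

text \<open>
  Node \<open>v\<^sub>i\<close> is represented by its index \<open>i < num_nodes\<close>. Its port \<open>q\<^sub>i\<^sub>-\<close> (\<open>Minus\<close>) leads to
  \<open>v\<^sub>i\<^sub>-\<^sub>1\<close> and \<open>q\<^sub>i\<^sub>+\<close> (\<open>Plus\<close>) to \<open>v\<^sub>i\<^sub>+\<^sub>1\<close>, indices modulo \<open>num_nodes\<close>. Indices of nodes and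
  of agents and the distinction \<open>Minus\<close>/\<open>Plus\<close> belong to the description of the system only:
  an agent perceives node identifiers, port labels, agent identifiers, and left/right as given
  by its own orientation.
\<close>

datatype side = Minus | Plus

datatype dir = Left | Right

record ('v, 'l, 'a) network =
  num_nodes :: nat
  node_id :: "nat \<Rightarrow> 'v"
  port_label :: "nat \<Rightarrow> side \<Rightarrow> 'l"
  team_size :: nat
  agent_id :: "nat \<Rightarrow> 'a"
  orient :: "nat \<Rightarrow> nat \<Rightarrow> side \<Rightarrow> dir" \<comment> \<open>agent, node, port\<close>

definition ring :: "('v, 'l, 'a) network \<Rightarrow> bool" where
  "ring N \<longleftrightarrow> num_nodes N \<ge> 3 \<and> (\<forall>i < num_nodes N. port_label N i Minus \<noteq> port_label N i Plus)"

definition oriented_team :: "('v, 'l, 'a) network \<Rightarrow> bool" where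
  "oriented_team N \<longleftrightarrow> team_size N \<ge> 1 \<and>
     (\<forall>j < team_size N.
        (\<forall>i < num_nodes N. orient N j i Minus \<noteq> orient N j i Plus) \<and>
        (\<forall>i < num_nodes N. \<forall>k < num_nodes N. \<forall>s. orient N j i s = orient N j k s))"

definition non_anonymous :: "('v, 'l, 'a) network \<Rightarrow> bool" where
  "non_anonymous N \<longleftrightarrow>
     inj_on (node_id N) {..<num_nodes N} \<and> inj_on (agent_id N) {..<team_size N}"

definition chirality :: "('v, 'l, 'a) network \<Rightarrow> bool" where
  "chirality N \<longleftrightarrow>
     (\<forall>j < team_size N. \<forall>k < team_size N. \<forall>i < num_nodes N. \<forall>s. orient N j i s = orient N k i s)"

fun neighbour :: "('v, 'l, 'a) network \<Rightarrow> nat \<Rightarrow> side \<Rightarrow> nat" where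
  "neighbour N i Plus = (i + 1) mod num_nodes N"
| "neighbour N i Minus = (i + num_nodes N - 1) mod num_nodes N"

text \<open>Edge \<open>i\<close> is the one between \<open>v\<^sub>i\<close> and \<open>v\<^sub>i\<^sub>+\<^sub>1\<close>.\<close>

fun edge_at :: "('v, 'l, 'a) network \<Rightarrow> nat \<Rightarrow> side \<Rightarrow> nat" where
  "edge_at N i Plus = i"
| "edge_at N i Minus = neighbour N i Minus"

text \<open>
  Positions within a node are of an option type; \<open>None\<close> means being at the node but on neither
  of its ports. In a snapshot, ports are named by the direction which the observing agent gives
  them. Other agents appear with their identifiers; since identifiers are distinct in the
  setting considered, a set does not lose multiplicities.
\<close>

record ('v, 'l, 'a) snapshot =
  seen_node :: 'v
  seen_labels :: "dir \<Rightarrow> 'l"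
  own_place :: "dir option"
  others :: "('a \<times> dir option) set"

text \<open>
  The arguments of \<open>compute\<close> are the agent's identifier, its memory, its flag \<open>moved\<close> and the
  snapshot; the result is its new memory and the direction, with \<open>None\<close> for nil.
\<close>

record ('v, 'l, 'a, 'm) protocol =
  init :: "'a \<Rightarrow> 'm"
  compute :: "'a \<Rightarrow> 'm \<Rightarrow> bool \<Rightarrow> ('v, 'l, 'a) snapshot \<Rightarrow> 'm \<times> dir option"

record 'm agent_state =
  node :: nat
  port :: "side option"
  memory :: 'm
  moved :: bool

type_synonym 'm config = "nat \<Rightarrow> 'm agent_state"


section \<open>Rounds and executions\<close>

definition port_of :: "('v, 'l, 'a) network \<Rightarrow> nat \<Rightarrow> nat \<Rightarrow> dir \<Rightarrow> side" where
  "port_of N j i d = (THE s. orient N j i s = d)"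

definition look ::
  "('v, 'l, 'a) network \<Rightarrow> 'm config \<Rightarrow> nat \<Rightarrow> ('v, 'l, 'a) snapshot" where
  "look N c j = (let i = node (c j) in
     \<lparr> seen_node = node_id N i,
       seen_labels = (\<lambda>d. port_label N i (port_of N j i d)),
       own_place = map_option (orient N j i) (port (c j)),
       others = {(agent_id N k, map_option (orient N j i) (port (c k))) | k.
                   k < team_size N \<and> k \<noteq> j \<and> node (c k) = i} \<rparr>)"

definition decision ::
  "('v, 'l, 'a) network \<Rightarrow> ('v, 'l, 'a, 'm) protocol \<Rightarrow> 'm config \<Rightarrow> nat \<Rightarrow> 'm \<times> dir option"
  where
  "decision N P c j = compute P (agent_id N j) (memory (c j)) (moved (c j)) (look N c j)"

definition target ::
  "('v, 'l, 'a) network \<Rightarrow> ('v, 'l, 'a, 'm) protocol \<Rightarrow> 'm config \<Rightarrow> nat \<Rightarrow> side option"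
  where
  "target N P c j = map_option (port_of N j (node (c j))) (snd (decision N P c j))"

definition occupied :: "('v, 'l, 'a) network \<Rightarrow> 'm config \<Rightarrow> nat \<Rightarrow> side \<Rightarrow> bool" where
  "occupied N c i s \<longleftrightarrow> (\<exists>k < team_size N. node (c k) = i \<and> port (c k) = Some s)"

text \<open>
  \<open>W\<close> is the set of active agents that are on the port of their choice after Compute. A port
  occupied at the beginning of the round, be it by an active or by a sleeping agent, cannot be
  gained in that round; of the agents competing for a free port exactly one gets it, and which
  one is left open, i.e. up to the adversary.
\<close>

definition port_access ::
  "('v, 'l, 'a) network \<Rightarrow> ('v, 'l, 'a, 'm) protocol \<Rightarrow> 'm config \<Rightarrow> nat set \<Rightarrow> nat set \<Rightarrow> bool"
  where
  "port_access N P c A W \<longleftrightarrow>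
     W \<subseteq> {j \<in> A. target N P c j \<noteq> None} \<and>
     (\<forall>j \<in> A. \<forall>s. target N P c j = Some s \<longrightarrow>
        (port (c j) = Some s \<longrightarrow> j \<in> W) \<and>
        (port (c j) \<noteq> Some s \<and> occupied N c (node (c j)) s \<longrightarrow> j \<notin> W) \<and>
        (\<not> occupied N c (node (c j)) s \<longrightarrow>
           (\<exists>!k. k \<in> W \<and> node (c k) = node (c j) \<and> target N P c k = Some s)))"

text \<open>
  State of an active agent \<open>j\<close> at the end of the round, where \<open>e\<close> is the missing edge, if any.
  An agent whose access fails keeps its place.
\<close>

definition act ::
  "('v, 'l, 'a) network \<Rightarrow> ('v, 'l, 'a, 'm) protocol \<Rightarrow> 'm config \<Rightarrow> nat set \<Rightarrow> nat option \<Rightarrow> nat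
     \<Rightarrow> 'm agent_state" where
  "act N P c W e j =
     (let a = (c j)\<lparr>memory := fst (decision N P c j)\<rparr> in
      case target N P c j of
        None \<Rightarrow> a
      | Some s \<Rightarrow>
          if j \<notin> W then a\<lparr>moved := False\<rparr>
          else if e = Some (edge_at N (node a) s) then a\<lparr>port := Some s, moved := False\<rparr>
          else a\<lparr>node := neighbour N (node a) s, port := None, moved := True\<rparr>)"

text \<open>In the No Simultaneity model a sleeping agent does not change at all.\<close>

definition ns_round ::
  "('v, 'l, 'a) network \<Rightarrow> ('v, 'l, 'a, 'm) protocol \<Rightarrow> nat set \<Rightarrow> nat option
     \<Rightarrow> 'm config \<Rightarrow> 'm config \<Rightarrow> bool" where
  "ns_round N P A e c c' \<longleftrightarrow>
     (\<exists>W. port_access N P c A W \<and>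
        (\<forall>j < team_size N. c' j = (if j \<in> A then act N P c W e j else c j)))"

definition initial ::
  "('v, 'l, 'a) network \<Rightarrow> ('v, 'l, 'a, 'm) protocol \<Rightarrow> 'm config \<Rightarrow> bool" where
  "initial N P c \<longleftrightarrow>
     (\<forall>j < team_size N. node (c j) < num_nodes N \<and> port (c j) = None \<and>
        memory (c j) = init P (agent_id N j) \<and> \<not> moved (c j))"

text \<open>
  The adversary chooses the initial nodes, for each round \<open>t\<close> the non-empty set \<open>A t\<close> of active
  agents and the missing edge \<open>E t\<close> (\<open>None\<close> if all edges are present), and who gains a
  contended port.
\<close>

definition ns_execution ::
  "('v, 'l, 'a) network \<Rightarrow> ('v, 'l, 'a, 'm) protocol \<Rightarrow> (nat \<Rightarrow> nat set) \<Rightarrow> (nat \<Rightarrow> nat option)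
     \<Rightarrow> (nat \<Rightarrow> 'm config) \<Rightarrow> bool" where
  "ns_execution N P A E c \<longleftrightarrow>
     initial N P (c 0) \<and>
     (\<forall>t. A t \<noteq> {} \<and> A t \<subseteq> {..<team_size N} \<and> set_option (E t) \<subseteq> {..<num_nodes N} \<and>
          ns_round N P (A t) (E t) (c t) (c (Suc t))) \<and>
     (\<forall>j < team_size N. infinite {t. j \<in> A t})"

definition explored :: "('v, 'l, 'a) network \<Rightarrow> (nat \<Rightarrow> 'm config) \<Rightarrow> bool" where
  "explored N c \<longleftrightarrow>
     (\<exists>T. \<forall>i < num_nodes N. \<exists>t \<le> T. \<exists>j < team_size N. node (c t j) = i)"

definition solves_exploration_NS ::
  "('v, 'l, 'a) network \<Rightarrow> ('v, 'l, 'a, 'm) protocol \<Rightarrow> bool" where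
  "solves_exploration_NS N P \<longleftrightarrow> (\<forall>A E c. ns_execution N P A E c \<longrightarrow> explored N c)"

end

theory Submission
  imports Defs
begin

text \<open>
  The adversary starts all agents at one node and activates them one at a time in round-robin
  order, each time removing the edge that the active agent is about to traverse. Since sleeping
  agents do not move, no agent ever leaves the initial node.
\<close>

text \<open>\<open>None\<close> arises from a nil decision, when no edge has to be missing.
  Otherwise the edge is removed whether or not the agent gains the port.\<close>

definition desired_edge ::
  "('v, 'l, 'a) network \<Rightarrow> ('v, 'l, 'a, 'm) protocol \<Rightarrow> 'm config \<Rightarrow> nat \<Rightarrow> nat option" where
  "desired_edge N P c j = map_option (edge_at N (node (c j))) (target N P c j)"

text \<open>With \<open>j\<close> alone active there is no contention, so the outcome is forced:
  this is the only set that \<open>port_access\<close> admits for \<open>{j}\<close>.\<close>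

definition solo_winners ::
  "('v, 'l, 'a) network \<Rightarrow> ('v, 'l, 'a, 'm) protocol \<Rightarrow> 'm config \<Rightarrow> nat \<Rightarrow> nat set" where
  "solo_winners N P c j =
     (case target N P c j of
        None \<Rightarrow> {}
      | Some s \<Rightarrow> if port (c j) = Some s \<or> \<not> occupied N c (node (c j)) s then {j} else {})"

definition blocked_step ::
  "('v, 'l, 'a) network \<Rightarrow> ('v, 'l, 'a, 'm) protocol \<Rightarrow> nat \<Rightarrow> 'm config \<Rightarrow> 'm config" where
  "blocked_step N P j c = c(j := act N P c (solo_winners N P c j) (desired_edge N P c j) j)"

primrec blocked_run ::
  "('v, 'l, 'a) network \<Rightarrow> ('v, 'l, 'a, 'm) protocol \<Rightarrow> 'm config \<Rightarrow> nat \<Rightarrow> 'm config" where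
  "blocked_run N P c 0 = c"
| "blocked_run N P c (Suc t) = blocked_step N P (t mod team_size N) (blocked_run N P c t)"

lemma edge_at_less: "edge_at N i s < num_nodes N" if "i < num_nodes N"
  using that by (cases s) auto

lemma port_access_solo_winners:
  assumes "j < team_size N"
  shows "port_access N P c {j} (solo_winners N P c j)"
proof -
  have "occupied N c (node (c j)) s" if "port (c j) = Some s" for s
    using assms that by (auto simp: occupied_def)
  then show ?thesis
    by (auto simp: port_access_def solo_winners_def split: option.splits if_splits)
qed

lemma ns_round_blocked_step:
  assumes "j < team_size N"
  shows "ns_round N P {j} (desired_edge N P c j) c (blocked_step N P j c)"
  using port_access_solo_winners[OF assms] by (auto simp: ns_round_def blocked_step_def)

text \<open>\<open>act\<close> changes a node only if the edge behind the gained port is present,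
  and \<open>desired_edge\<close> is exactly that edge. All agents other than \<open>j\<close> sleep
  and keep their state.\<close>

lemma node_blocked_step: "node (blocked_step N P j c k) = node (c k)"
  by (auto simp: blocked_step_def act_def desired_edge_def Let_def split: option.splits)

lemma node_blocked_run: "node (blocked_run N P c t k) = node (c k)"
  by (induction t) (simp_all add: node_blocked_step)

text \<open>Gives the fairness of the round-robin schedule.\<close>

lemma infinite_mod_eq: "infinite {t. t mod k = j}" if "j < k" for j k :: nat
proof
  assume "finite {t. t mod k = j}"
  then obtain m where m: "\<forall>t \<in> {t. t mod k = j}. t < m"
    using finite_nat_set_iff_bounded by blast
  \<comment> \<open>A member of the residue class that is at least \<open>m\<close>, since
    \<open>j < k\<close> forces \<open>k\<close> to be positive.\<close>
  have "(j + k * m) mod k = j"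
    using that by (metis mod_less mod_mult_self2)
  then have "j + k * m < m"
    using m by blast
  then show False
    using that by (cases k) auto
qed

text \<open>The adversary reacts to the current configuration. As the protocol is deterministic, the
  run is built first by recursion and the missing edges are then read off it as a function of
  time.\<close>

lemma ns_execution_blocked_run:
  assumes "team_size N \<ge> 1" and "initial N P c"
  shows "ns_execution N P (\<lambda>t. {t mod team_size N})
    (\<lambda>t. desired_edge N P (blocked_run N P c t) (t mod team_size N)) (blocked_run N P c)"
proof -
  have less: "t mod team_size N < team_size N" for t
    using assms(1) by simp
  \<comment> \<open>A bound in the initial configuration suffices for all rounds, because nodes are
    constant along the run.\<close>
  have "node (c (t mod team_size N)) < num_nodes N" for t
    using assms(2) less by (simp add: initial_def)
  then have edges: "set_option (desired_edge N P (blocked_run N P c t) (t mod team_size N))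
      \<subseteq> {..<num_nodes N}" for t
    by (auto simp: desired_edge_def node_blocked_run edge_at_less)
  have "infinite {t. j \<in> {t mod team_size N}}" if "j < team_size N" for j
    using infinite_mod_eq[OF that] by (simp add: eq_commute)
  then show ?thesis
    using assms(2) less edges by (simp add: ns_execution_def ns_round_blocked_step)
qed

theorem theorem9:
  fixes N :: "('v, 'l, 'a) network"
  assumes "ring N" and "oriented_team N" and "non_anonymous N" and "chirality N"
  shows "\<nexists>P :: ('v, 'l, 'a, 'm) protocol. solves_exploration_NS N P"
proof
  assume "\<exists>P :: ('v, 'l, 'a, 'm) protocol. solves_exploration_NS N P"
  then obtain P :: "('v, 'l, 'a, 'm) protocol" where P: "solves_exploration_NS N P"
    by blast
  define c :: "'m config" where
    "c j = \<lparr>node = 0, port = None, memory = init P (agent_id N j), moved = False\<rparr>" for j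
  have nodes: "num_nodes N \<ge> 3"
    using assms(1) by (simp add: ring_def)
  then have "initial N P c"
    by (simp add: initial_def c_def)
  moreover have "team_size N \<ge> 1"
    using assms(2) by (simp add: oriented_team_def)
  ultimately have "explored N (blocked_run N P c)"
    using P ns_execution_blocked_run unfolding solves_exploration_NS_def by blast
  \<comment> \<open>Node 1 exists and would have to be visited, while every agent stays at node
    0.\<close>
  moreover have "1 < num_nodes N"
    using nodes by simp
  ultimately obtain t j where "node (blocked_run N P c t j) = 1"
    unfolding explored_def by blast
  then show False
    by (simp add: node_blocked_run c_def)
qed

end
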